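(* The quantum double Bruhat cell $\mathbb C_t[\mathrm{SL}_2^{w_0,w_0}]$ is isomorphic, as an algebra over $\mathbb C(t)$, to the localized quantum oscillator algebra $\mathcal U_{t,\mathrm{loc}}^+$.
   Context: All algebras are taken over $\mathbb C(t)$. The quantum oscillator algebra $\mathcal U_t^+(\mathfrak{sl}_2)$ has generators $e,f,k^{\pm1}$ and relations $kk^{-1}=k^{-1}k=1$, $ke=t^2ek$, $kf=t^{-2}fk$, $[e,f]=\frac{k}{t-t^{-1}}$. Its Casimir element is $C=ef+\frac{t^{-1}k}{(t-t^{-1})^2}=fe+\frac{tk}{(t-t^{-1})^2}$, which is central. $\mathcal U_{t,\mathrm{loc}}^+$ is $\mathcal U_t^+(\mathfrak{sl}_2)$ localized at $C$ and extended by square roots $k^{\pm\frac12}$ of $k^{\pm1}$, with $k^{\frac12}e=t\,e\,k^{\frac12}$ and $k^{\frac12}f=t^{-1}f\,k^{\frac12}$. The quantum double Bruhat cell $\mathbb C_t[\mathrm{SL}_2^{w_0,w_0}]$ ($w_0$ the longest element, i.e. the simple reflection, of the Weyl group of $\mathfrak{sl}_2$) is the algebra with generators $a,b^{\pm1},c^{\pm1},d$ and relations $ab=t\,ba$, $ac=t\,ca$, $bd=t\,db$, $cd=t\,dc$, $bc=cb$, $bb^{-1}=b^{-1}b=1$, $cc^{-1}=c^{-1}c=1$, and $ad-t\,bc=1=da-t^{-1}bc$. *)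

theory Defs
  imports
    "HOL-Algebra.QuotRing"
    "HOL-Algebra.Module"
    "HOL-Library.Poly_Mapping"
    "HOL-Computational_Algebra.Fraction_Field"
    "HOL-Computational_Algebra.Polynomial"
begin

section \<open>Free associative algebras\<close>

text \<open>Words, i.e. the free monoid on \<open>'g\<close>, written additively because the convolution product
  on \<^typ>\<open>'a \<Rightarrow>\<^sub>0 'b\<close> is defined over an additive (not necessarily commutative) monoid
  of exponents. Hence \<open>'g word \<Rightarrow>\<^sub>0 'k\<close> is the free associative unital \<open>'k\<close>-algebra on \<open>'g\<close>.\<close>

datatype 'g word = Word (letters: "'g list")

instantiation word :: (type) monoid_add
begin

definition zero_word :: "'a word" where "0 = Word []"

definition plus_word :: "'a word \<Rightarrow> 'a word \<Rightarrow> 'a word"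
  where "u + v = Word (letters u @ letters v)"

instance
  by standard (simp_all add: zero_word_def plus_word_def)

end

type_synonym ('g, 'k) free_alg = "'g word \<Rightarrow>\<^sub>0 'k"

definition gen :: "'g \<Rightarrow> ('g, 'k::comm_ring_1) free_alg"
  where "gen g = Poly_Mapping.single (Word [g]) 1"

definition scal :: "'k \<Rightarrow> ('g, 'k::comm_ring_1) free_alg"
  where "scal c = Poly_Mapping.single 0 c"

definition free_ring :: "('g, 'k::comm_ring_1) free_alg ring"
  where "free_ring = \<lparr>carrier = UNIV, monoid.mult = (*), one = 1, zero = 0, add = (+)\<rparr>"

lemma free_ring_simps [simp]:
  "carrier free_ring = UNIV"
  "x \<otimes>\<^bsub>free_ring\<^esub> y = x * y"
  "\<one>\<^bsub>free_ring\<^esub> = 1"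
  "\<zero>\<^bsub>free_ring\<^esub> = 0"
  "x \<oplus>\<^bsub>free_ring\<^esub> y = x + y"
  by (simp_all add: free_ring_def)

lemma ring_free_ring: "ring (free_ring :: ('g, 'k::comm_ring_1) free_alg ring)"
proof (rule ringI)
  show "abelian_group (free_ring :: ('g, 'k) free_alg ring)"
    by (rule abelian_groupI)
       (auto simp: algebra_simps intro: exI[of _ "- _"])
  show "Group.monoid (free_ring :: ('g, 'k) free_alg ring)"
    by (rule Group.monoidI) (auto simp: algebra_simps)
qed (auto simp: algebra_simps)


section \<open>Algebras presented by generators and relations\<close>

text \<open>A set of pairs \<open>(l, r)\<close> stands for the relations \<open>l = r\<close>.\<close>

definition rel_ideal ::
    "(('g, 'k::comm_ring_1) free_alg \<times> ('g, 'k) free_alg) set \<Rightarrow> ('g, 'k) free_alg set"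
  where "rel_ideal R = Idl\<^bsub>free_ring\<^esub> {l - r | l r. (l, r) \<in> R}"

definition presented_ring ::
    "(('g, 'k::comm_ring_1) free_alg \<times> ('g, 'k) free_alg) set \<Rightarrow> ('g, 'k) free_alg set ring"
  where "presented_ring R = free_ring Quot rel_ideal R"

text \<open>We use the record \<^typ>\<open>('k, 'a) module\<close>, which extends rings by a scalar multiplication; the
  locale \<open>algebra\<close> over it is restricted to commutative algebras and hence not applicable.\<close>

definition presented_algebra ::
    "(('g, 'k::comm_ring_1) free_alg \<times> ('g, 'k) free_alg) set
      \<Rightarrow> ('k, ('g, 'k) free_alg set) module"
  where "presented_algebra R = ring.extend (presented_ring R)
    (module.fields (\<lambda>c X. (rel_ideal R +>\<^bsub>free_ring\<^esub> scal c) \<otimes>\<^bsub>presented_ring R\<^esub> X))"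

text \<open>Isomorphisms of unital associative algebras: scalar-linear ring isomorphisms.\<close>

definition alg_iso :: "('k, 'a) module \<Rightarrow> ('k, 'b) module \<Rightarrow> ('a \<Rightarrow> 'b) set"
  where "alg_iso A B = {h \<in> ring_iso A B.
    \<forall>c. \<forall>x \<in> carrier A. h (c \<odot>\<^bsub>A\<^esub> x) = c \<odot>\<^bsub>B\<^esub> h x}"

lemma ideal_rel_ideal: "ideal (rel_ideal R) free_ring"
  unfolding rel_ideal_def by (rule ring.genideal_ideal[OF ring_free_ring]) simp

lemma ring_presented_ring: "ring (presented_ring R)"
  unfolding presented_ring_def by (rule ideal.quotient_is_ring[OF ideal_rel_ideal])


section \<open>The base field and the two algebras\<close>

type_synonym Ct = "complex poly fract"

definition tt :: Ct where "tt = Fraction_Field.Fract [:0, 1:] 1"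

text \<open>The relations of the quantum oscillator algebra and its Casimir element are stated for
  arbitrary elements of a free algebra, so that they can be reused for the localized algebra, which
  has more generators. The arguments \<open>k'\<close>, \<open>h'\<close> below stand for inverses of \<open>k\<close>, \<open>h\<close>.\<close>

definition osc_relations ::
    "('g, Ct) free_alg \<Rightarrow> ('g, Ct) free_alg \<Rightarrow> ('g, Ct) free_alg \<Rightarrow> ('g, Ct) free_alg
      \<Rightarrow> (('g, Ct) free_alg \<times> ('g, Ct) free_alg) set"
  where "osc_relations e f k k' =
   {(k * k', 1),
    (k' * k, 1),
    (k * e, scal (tt ^ 2) * e * k),
    (k * f, scal (inverse (tt ^ 2)) * f * k),
    (e * f - f * e, scal (1 / (tt - inverse tt)) * k)}"

definition casimir ::
    "('g, Ct) free_alg \<Rightarrow> ('g, Ct) free_alg \<Rightarrow> ('g, Ct) free_alg \<Rightarrow> ('g, Ct) free_alg"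
  where "casimir e f k = e * f + scal (inverse tt / (tt - inverse tt) ^ 2) * k"

datatype osc_gen = E | F | K | Kinv

definition quantum_oscillator :: "(Ct, (osc_gen, Ct) free_alg set) module"
  where "quantum_oscillator =
    presented_algebra (osc_relations (gen E) (gen F) (gen K) (gen Kinv))"

text \<open>Square roots \<open>h\<close>, \<open>h'\<close> of \<open>k\<close>, \<open>k'\<close>.\<close>

definition sqrt_relations ::
    "('g, Ct) free_alg \<Rightarrow> ('g, Ct) free_alg \<Rightarrow> ('g, Ct) free_alg \<Rightarrow> ('g, Ct) free_alg
      \<Rightarrow> ('g, Ct) free_alg \<Rightarrow> ('g, Ct) free_alg \<Rightarrow> (('g, Ct) free_alg \<times> ('g, Ct) free_alg) set"
  where "sqrt_relations e f k k' h h' =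
   {(h * h, k),
    (h' * h', k'),
    (h * h', 1),
    (h' * h, 1),
    (h * e, scal tt * e * h),
    (h * f, scal (inverse tt) * f * h)}"

text \<open>Since the Casimir element is central (see the end of this theory), localizing at it amounts
  to adjoining a two-sided inverse of it; this inverse is the generator \<open>Cinv\<close>.\<close>

datatype osc_loc_gen = Osc osc_gen | Khalf | Khalfinv | Cinv

definition osc_loc_relations ::
    "((osc_loc_gen, Ct) free_alg \<times> (osc_loc_gen, Ct) free_alg) set"
  where "osc_loc_relations =
   (let e = gen (Osc E); f = gen (Osc F); k = gen (Osc K); k' = gen (Osc Kinv);
        h = gen Khalf; h' = gen Khalfinv
    in osc_relations e f k k' \<union> sqrt_relations e f k k' h h' \<union>
       {(casimir e f k * gen Cinv, 1),
        (gen Cinv * casimir e f k, 1)})"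

definition quantum_oscillator_loc :: "(Ct, (osc_loc_gen, Ct) free_alg set) module"
  where "quantum_oscillator_loc = presented_algebra osc_loc_relations"

datatype cell_gen = Ga | Gb | Gbinv | Gc | Gcinv | Gd

definition cell_relations :: "((cell_gen, Ct) free_alg \<times> (cell_gen, Ct) free_alg) set"
  where "cell_relations =
   (let a = gen Ga; b = gen Gb; b' = gen Gbinv; c = gen Gc; c' = gen Gcinv; d = gen Gd
    in {(a * b, scal tt * b * a),
        (a * c, scal tt * c * a),
        (b * d, scal tt * d * b),
        (c * d, scal tt * d * c),
        (b * c, c * b),
        (b * b', 1),
        (b' * b, 1),
        (c * c', 1),
        (c' * c, 1),
        (a * d - scal tt * b * c, 1),
        (d * a - scal (inverse tt) * b * c, 1)})"

definition quantum_double_bruhat_cell_SL2 :: "(Ct, (cell_gen, Ct) free_alg set) module"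
  where "quantum_double_bruhat_cell_SL2 = presented_algebra cell_relations"

section \<open>Centrality of the Casimir element\<close>

context
  fixes R :: "(('g, 'k::comm_ring_1) free_alg \<times> ('g, 'k) free_alg) set"
begin

lemma rel_ideal_zero: "0 \<in> rel_ideal R"
  using additive_subgroup.zero_closed[OF ideal.axioms(1)[OF ideal_rel_ideal]] by simp

lemma rel_ideal_add: "x \<in> rel_ideal R \<Longrightarrow> y \<in> rel_ideal R \<Longrightarrow> x + y \<in> rel_ideal R"
  using additive_subgroup.a_closed[OF ideal.axioms(1)[OF ideal_rel_ideal]] by fastforce

lemma rel_ideal_mult_left: "x \<in> rel_ideal R \<Longrightarrow> y * x \<in> rel_ideal R"
  using ideal.I_l_closed[OF ideal_rel_ideal] by fastforce

lemma rel_ideal_mult_right: "x \<in> rel_ideal R \<Longrightarrow> x * y \<in> rel_ideal R"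
  using ideal.I_r_closed[OF ideal_rel_ideal] by fastforce

lemma rel_ideal_uminus: "x \<in> rel_ideal R \<Longrightarrow> - x \<in> rel_ideal R"
  using rel_ideal_mult_left[of x "- 1"] by simp

lemma rel_ideal_diff: "x \<in> rel_ideal R \<Longrightarrow> y \<in> rel_ideal R \<Longrightarrow> x - y \<in> rel_ideal R"
  using rel_ideal_add[of x "- y"] rel_ideal_uminus[of y] by simp

lemma rel_ideal_relation: "(l, r) \<in> R \<Longrightarrow> l - r \<in> rel_ideal R"
  unfolding rel_ideal_def
  by (rule subsetD[OF ring.genideal_self[OF ring_free_ring]]) auto

end

lemma scal_zero: "scal 0 = 0"
  and scal_one: "scal 1 = 1"
  and scal_add: "scal (c + d) = scal c + scal d"
  and scal_diff: "scal (c - d) = scal c - scal d"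
  and scal_uminus: "scal (- c) = - scal c"
  and scal_mult: "scal (c * d) = scal c * scal d"
  by (simp_all add: scal_def single_add single_diff single_uminus mult_single)

lemma poly_mapping_add_induct [case_names zero single add]:
  fixes x :: "'a \<Rightarrow>\<^sub>0 'b::monoid_add"
  assumes "P 0" and "\<And>w v. P (Poly_Mapping.single w v)"
    and "\<And>x y. P x \<Longrightarrow> P y \<Longrightarrow> P (x + y)"
  shows "P x"
proof (induction x rule: update_induct)
  case (update f a b)
  have "Poly_Mapping.update a b f = f + Poly_Mapping.single a b"
    using update.hyps(1)
    by (intro poly_mapping_eqI) (auto simp: lookup_update lookup_add lookup_single when_def in_keys_iff)
  then show ?case using update assms by simp
qed (rule assms(1))

lemma scal_commute: "x * scal c = scal c * x"
proof (induction x rule: poly_mapping_add_induct)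
  case (single w v)
  show ?case by (simp add: scal_def mult_single mult.commute)
qed (simp_all add: algebra_simps)

lemma scal_left: "x * (scal c * y) = scal c * (x * y)"
  by (metis mult.assoc scal_commute)

text \<open>An element of a presented algebra is central once it commutes with the generators.\<close>

lemma commute_mod_gen_imp_central:
  fixes R :: "(('g, 'k::comm_ring_1) free_alg \<times> ('g, 'k) free_alg) set"
  assumes "\<And>g. z * gen g - gen g * z \<in> rel_ideal R"
  shows "z * x - x * z \<in> rel_ideal R"
proof (induction x rule: poly_mapping_add_induct)
  case (single w v)
  obtain gs where w: "w = Word gs" by (cases w)
  show ?case unfolding w
  proof (induction gs)
    case Nil
    have "Poly_Mapping.single (Word []) v = (scal v :: ('g, 'k) free_alg)"
      by (simp add: scal_def zero_word_def)
    then show ?case by (simp add: scal_commute rel_ideal_zero)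
  next
    case (Cons g gs)
    let ?y = "Poly_Mapping.single (Word gs) v :: ('g, 'k) free_alg"
    have split: "Poly_Mapping.single (Word (g # gs)) v = gen g * ?y"
      by (simp add: gen_def mult_single plus_word_def)
    have "z * (gen g * ?y) - (gen g * ?y) * z
        = (z * gen g - gen g * z) * ?y + gen g * (z * ?y - ?y * z)"
      by (simp add: algebra_simps)
    then show ?case unfolding split
      using assms Cons.IH by (simp add: rel_ideal_add rel_ideal_mult_left rel_ideal_mult_right)
  qed
next
  case zero
  show ?case by (simp add: rel_ideal_zero)
next
  case (add x y)
  have "z * (x + y) - (x + y) * z = (z * x - x * z) + (z * y - y * z)"
    by (simp add: algebra_simps)
  then show ?case using add by (simp add: rel_ideal_add)
qed

lemma tt_nonzero: "tt \<noteq> 0"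
  and tt_diff_nonzero: "tt - inverse tt \<noteq> 0"
proof -
  show 1: "tt \<noteq> 0"
    by (simp add: tt_def Zero_fract_def eq_fract)
  have "tt * tt \<noteq> 1"
    by (simp add: tt_def One_fract_def eq_fract one_pCons)
  then show "tt - inverse tt \<noteq> 0"
    using 1 by (metis eq_iff_diff_eq_0 right_inverse)
qed

lemma commutes_inverse:
  assumes "z * x - x * z \<in> rel_ideal R"
    and "x * x' - 1 \<in> rel_ideal R" and "x' * x - 1 \<in> rel_ideal R"
  shows "z * x' - x' * z \<in> rel_ideal R"
proof -
  have "z * x' - x' * z
      = x' * z * (x * x' - 1) - (x' * (z * x - x * z) * x' + (x' * x - 1) * (z * x'))"
    by (simp add: algebra_simps)
  then show ?thesis
    using assms
    by (simp only: rel_ideal_add rel_ideal_diff rel_ideal_mult_left rel_ideal_mult_right)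
qed

text \<open>Below, \<open>R\<close> is any set of relations containing those of the oscillator algebra for \<open>e, f, k, k'\<close>.\<close>

context
  fixes R :: "(('g, Ct) free_alg \<times> ('g, Ct) free_alg) set"
    and e f k k' :: "('g, Ct) free_alg"
  assumes R: "osc_relations e f k k' \<subseteq> R"
begin

lemma casimir_alt:
  "casimir e f k - (f * e + scal (tt / (tt - inverse tt) ^ 2) * k) \<in> rel_ideal R"
proof -
  define d where "d = tt - inverse tt"
  have "tt / d ^ 2 - inverse tt / d ^ 2 = d / d ^ 2"
    by (simp add: d_def diff_divide_distrib)
  also have "\<dots> = 1 / d"
    using tt_diff_nonzero by (simp add: d_def power2_eq_square)
  finally have *: "scal (1 / d) = (scal (tt / d ^ 2) - scal (inverse tt / d ^ 2) :: ('g, Ct) free_alg)"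
    by (metis scal_diff)
  have "casimir e f k - (f * e + scal (tt / d ^ 2) * k) = (e * f - f * e) - scal (1 / d) * k"
    unfolding * by (simp add: casimir_def algebra_simps flip: d_def)
  also have "\<dots> \<in> rel_ideal R"
    by (rule rel_ideal_relation) (use R in \<open>auto simp: osc_relations_def d_def\<close>)
  finally show ?thesis by (simp add: d_def)
qed

lemma ke: "k * e - scal (tt ^ 2) * e * k \<in> rel_ideal R"
  and kf: "k * f - scal (inverse (tt ^ 2)) * f * k \<in> rel_ideal R"
  and kk': "k * k' - 1 \<in> rel_ideal R"
  and k'k: "k' * k - 1 \<in> rel_ideal R"
  by (rule rel_ideal_relation; use R in \<open>auto simp: osc_relations_def\<close>)+

lemma casimir_commutes_e: "casimir e f k * e - e * casimir e f k \<in> rel_ideal R"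
proof -
  define p where "p = inverse tt / (tt - inverse tt) ^ 2"
  define q where "q = tt / (tt - inverse tt) ^ 2"
  have q: "q = p * tt ^ 2"
    using tt_nonzero by (simp add: p_def q_def power2_eq_square)
  define D where "D = casimir e f k - (f * e + scal q * k)"
  have D: "D \<in> rel_ideal R"
    using casimir_alt by (simp add: D_def q_def)
  have "e * (scal q * k) = scal p * (scal (tt ^ 2) * e * k)"
    by (simp only: scal_left[of e] q scal_mult mult.assoc)
  then have "casimir e f k * e - e * casimir e f k
      = scal p * (k * e - scal (tt ^ 2) * e * k) - e * D"
    by (simp add: D_def algebra_simps casimir_def flip: p_def)
  then show ?thesis
    using D ke by (simp add: rel_ideal_diff rel_ideal_mult_left)
qed

lemma casimir_commutes_f: "casimir e f k * f - f * casimir e f k \<in> rel_ideal R"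
proof -
  define p where "p = inverse tt / (tt - inverse tt) ^ 2"
  define q where "q = tt / (tt - inverse tt) ^ 2"
  have p: "p = q * inverse (tt ^ 2)"
    using tt_nonzero by (simp add: p_def q_def power2_eq_square field_simps)
  define D where "D = casimir e f k - (f * e + scal q * k)"
  have D: "D \<in> rel_ideal R"
    using casimir_alt by (simp add: D_def q_def)
  have "f * (scal p * k) = scal q * (scal (inverse (tt ^ 2)) * f * k)"
    by (simp only: scal_left[of f] p scal_mult mult.assoc)
  moreover have "casimir e f k = D + f * e + scal q * k"
    by (simp add: D_def)
  then have "casimir e f k * f = D * f + f * (e * f) + scal q * (k * f)"
    by (simp add: algebra_simps)
  ultimately have "casimir e f k * f - f * casimir e f k
      = scal q * (k * f - scal (inverse (tt ^ 2)) * f * k) + D * f"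
    by (simp add: algebra_simps casimir_def flip: p_def)
  then show ?thesis
    using D kf by (simp add: rel_ideal_add rel_ideal_mult_left rel_ideal_mult_right)
qed

text \<open>Anything that scales \<open>e\<close> and \<open>f\<close> inversely and commutes with \<open>k\<close> commutes with the
  Casimir element; this applies to \<open>k\<close> and to its square root.\<close>

lemma casimir_commutes_torus:
  assumes xe: "x * e - scal c * e * x \<in> rel_ideal R"
    and xf: "x * f - scal c' * f * x \<in> rel_ideal R"
    and xk: "x * k - k * x \<in> rel_ideal R"
    and cc': "c * c' = 1"
  shows "casimir e f k * x - x * casimir e f k \<in> rel_ideal R"
proof -
  define p where "p = inverse tt / (tt - inverse tt) ^ 2"
  have 1: "x * (scal p * y) = scal p * (x * y)" for y
    by (rule scal_left)
  have 2: "scal c * (e * (scal c' * (f * x))) = e * (f * x)"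
    by (simp add: scal_left[of e] cc' scal_one flip: scal_mult mult.assoc[of "scal c" "scal c'"])
  have "casimir e f k * x - x * casimir e f k
      = - ((x * e - scal c * e * x) * f + scal c * e * (x * f - scal c' * f * x)
            + scal p * (x * k - k * x))"
    by (simp add: casimir_def algebra_simps 1 2 flip: p_def)
  then show ?thesis
    using xe xf xk
    by (simp only: rel_ideal_add rel_ideal_uminus rel_ideal_mult_left rel_ideal_mult_right)
qed

lemma casimir_commutes_k: "casimir e f k * k - k * casimir e f k \<in> rel_ideal R"
  by (rule casimir_commutes_torus[OF ke kf])
     (use tt_nonzero in \<open>simp_all add: rel_ideal_zero\<close>)

lemma casimir_commutes_k': "casimir e f k * k' - k' * casimir e f k \<in> rel_ideal R"
  by (rule commutes_inverse[OF casimir_commutes_k kk' k'k])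

lemma casimir_commutes_sqrt:
  assumes S: "sqrt_relations e f k k' h h' \<subseteq> R"
  shows "casimir e f k * h - h * casimir e f k \<in> rel_ideal R"
    and "casimir e f k * h' - h' * casimir e f k \<in> rel_ideal R"
proof -
  note mem = subsetD[OF S] and rel = rel_ideal_relation[of _ _ R]
  have hh: "h * h - k \<in> rel_ideal R"
    and he: "h * e - scal tt * e * h \<in> rel_ideal R"
    and hf: "h * f - scal (inverse tt) * f * h \<in> rel_ideal R"
    and hh': "h * h' - 1 \<in> rel_ideal R" and h'h: "h' * h - 1 \<in> rel_ideal R"
    by (rule rel; rule mem; simp add: sqrt_relations_def)+
  have "h * k - k * h = (h * h - k) * h - h * (h * h - k)"
    by (simp add: algebra_simps)
  then have hk: "h * k - k * h \<in> rel_ideal R"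
    using hh by (simp only: rel_ideal_diff rel_ideal_mult_left rel_ideal_mult_right)
  show 1: "casimir e f k * h - h * casimir e f k \<in> rel_ideal R"
    by (rule casimir_commutes_torus[OF he hf hk]) (simp add: tt_nonzero)
  show "casimir e f k * h' - h' * casimir e f k \<in> rel_ideal R"
    by (rule commutes_inverse[OF 1 hh' h'h])
qed

end

lemma casimir_central:
  defines "R \<equiv> osc_relations (gen E) (gen F) (gen K) (gen Kinv)"
    and "z \<equiv> casimir (gen E) (gen F) (gen K)"
  shows "z * x - x * z \<in> rel_ideal R"
proof (rule commute_mod_gen_imp_central)
  have R: "osc_relations (gen E) (gen F) (gen K) (gen Kinv) \<subseteq> R"
    by (simp add: R_def)
  show "z * gen g - gen g * z \<in> rel_ideal R" for g
    unfolding z_def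
    by (cases g)
       (simp_all add: casimir_commutes_e[OF R] casimir_commutes_f[OF R]
          casimir_commutes_k[OF R] casimir_commutes_k'[OF R])
qed

lemma casimir_central_loc:
  defines "z \<equiv> casimir (gen (Osc E)) (gen (Osc F)) (gen (Osc K))"
  shows "z * x - x * z \<in> rel_ideal osc_loc_relations"
proof (rule commute_mod_gen_imp_central)
  let ?I = "rel_ideal osc_loc_relations"
  have R: "osc_relations (gen (Osc E)) (gen (Osc F)) (gen (Osc K)) (gen (Osc Kinv))
      \<subseteq> osc_loc_relations"
    and S: "sqrt_relations (gen (Osc E)) (gen (Osc F)) (gen (Osc K)) (gen (Osc Kinv))
      (gen Khalf) (gen Khalfinv) \<subseteq> osc_loc_relations"
    by (auto simp: osc_loc_relations_def Let_def)
  have "z * gen Cinv - 1 \<in> ?I" "gen Cinv * z - 1 \<in> ?I"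
    by (rule rel_ideal_relation; simp add: osc_loc_relations_def z_def Let_def)+
  then have "(z * gen Cinv - 1) - (gen Cinv * z - 1) \<in> ?I"
    by (rule rel_ideal_diff)
  then have inv: "z * gen Cinv - gen Cinv * z \<in> ?I" by simp
  show "z * gen g - gen g * z \<in> ?I" for g
  proof (cases g)
    case (Osc g')
    then show ?thesis unfolding z_def
      by (cases g')
         (simp_all add: casimir_commutes_e[OF R] casimir_commutes_f[OF R]
            casimir_commutes_k[OF R] casimir_commutes_k'[OF R])
  next
    case Khalf
    then show ?thesis unfolding z_def by (simp add: casimir_commutes_sqrt[OF R S])
  next
    case Khalfinv
    then show ?thesis unfolding z_def by (simp add: casimir_commutes_sqrt[OF R S])
  next
    case Cinv
    then show ?thesis using inv by simp
  qed
qed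

end

theory Submission
  imports Defs
begin

text \<open>
  Write \<open>h\<close> for \<open>k\<^sup>1\<^sup>/\<^sup>2\<close>, \<open>C\<close> for the Casimir element and \<open>\<kappa> = - 1/(t - t\<^sup>-\<^sup>1)\<^sup>2\<close>. The two expressions for
  \<open>C\<close> say \<open>e f = C + \<kappa> t\<^sup>-\<^sup>1 k\<close> and \<open>f e = C + \<kappa> t k\<close>. After division by the central unit \<open>C\<close> these are
  the determinant relations \<open>d a = 1 + t\<^sup>-\<^sup>1 b c\<close> and \<open>a d = 1 + t b c\<close> of the cell for
  \<open>a = f\<close>, \<open>d = e C\<^sup>-\<^sup>1\<close> and any \<open>b\<close>, \<open>c\<close> with \<open>b c = \<kappa> k C\<^sup>-\<^sup>1\<close>. The square root of \<open>k\<close> makes it possible to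
  split this product into two units that scale \<open>a\<close> and \<open>d\<close> by \<open>t\<^sup>\<plusminus>\<^sup>1\<close>, namely \<open>b = h\<close> and
  \<open>c = \<kappa> h C\<^sup>-\<^sup>1\<close>.

  Solving for the oscillator generators gives the inverse: \<open>C = \<kappa> b c\<^sup>-\<^sup>1\<close>, which is central in
  the cell because \<open>b\<close> and \<open>c\<close> scale \<open>a\<close> and \<open>d\<close> by the same powers of \<open>t\<close>, and then
  \<open>f = a\<close>, \<open>e = d C\<close>, \<open>k\<^sup>1\<^sup>/\<^sup>2 = b\<close>.

  An assignment of generators induces a homomorphism of presented algebras once it respects the
  defining relations (\<open>substitute_rel_cong\<close>), and two such assignments that invert each other on
  generators give an isomorphism (\<open>alg_iso_presented_algebra\<close>). So the proof consists of checking
  finitely many congruences modulo the relations. Many of them say that two elements commute up to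
  a power of \<open>t\<close>, which is stable under products, scalars and inverses; the remaining ones are the
  determinant relations, the commutator of \<open>e\<close> and \<open>f\<close>, and the identification of the Casimir
  element.
\<close>

section \<open>Substitution homomorphisms\<close>

text \<open>The algebra homomorphism out of the free algebra that extends \<open>\<phi>\<close>.\<close>

definition substitute ::
    "('g \<Rightarrow> ('h, 'k::comm_ring_1) free_alg) \<Rightarrow> ('g, 'k) free_alg \<Rightarrow> ('h, 'k) free_alg"
  where "substitute \<phi> x =
    (\<Sum>w\<in>Poly_Mapping.keys x. scal (Poly_Mapping.lookup x w) * prod_list (map \<phi> (letters w)))"

lemma substitute_zero: "substitute \<phi> 0 = 0"
  by (simp add: substitute_def)

lemma substitute_add: "substitute \<phi> (x + y) = substitute \<phi> x + substitute \<phi> y"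
  unfolding substitute_def
  by (rule setsum_keys_plus_distrib) (simp_all add: scal_zero scal_add distrib_right)

lemma substitute_single:
  "substitute \<phi> (Poly_Mapping.single w v) = scal v * prod_list (map \<phi> (letters w))"
  by (simp add: substitute_def scal_zero)

lemma substitute_mult: "substitute \<phi> (x * y) = substitute \<phi> x * substitute \<phi> y"
proof (induction x rule: poly_mapping_add_induct)
  case (single w v)
  show ?case
  proof (induction y rule: poly_mapping_add_induct)
    case (single w' v')
    show ?case
      by (simp add: mult_single substitute_single scal_mult plus_word_def mult.assoc
          scal_left[of "prod_list _"])
  qed (simp_all add: substitute_zero substitute_add distrib_left)
qed (simp_all add: substitute_zero substitute_add distrib_right)

lemma substitute_uminus: "substitute \<phi> (- x) = - substitute \<phi> x"
  using substitute_add[of \<phi> x "- x"] by (simp add: substitute_zero add_eq_0_iff)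

lemma substitute_diff: "substitute \<phi> (x - y) = substitute \<phi> x - substitute \<phi> y"
  using substitute_add[of \<phi> x "- y"] by (simp add: substitute_uminus)

lemma substitute_scal: "substitute \<phi> (scal c) = scal c"
  by (simp add: scal_def[of c] substitute_single zero_word_def)

lemma substitute_one: "substitute \<phi> 1 = 1"
  using substitute_scal[of \<phi> 1] by (simp add: scal_one)

lemma substitute_gen: "substitute \<phi> (gen g) = \<phi> g"
  by (simp add: gen_def substitute_single scal_one)

lemmas substitute_simps = substitute_zero substitute_one substitute_add substitute_diff
  substitute_uminus substitute_mult substitute_scal substitute_gen

lemma substitute_ring_hom: "substitute \<phi> \<in> ring_hom free_ring free_ring"
  by (auto simp: ring_hom_def substitute_simps)


section \<open>Congruence modulo relations\<close>

definition rel_cong ::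
    "('g, 'k::comm_ring_1) free_alg \<Rightarrow> (('g, 'k) free_alg \<times> ('g, 'k) free_alg) set
      \<Rightarrow> ('g, 'k) free_alg \<Rightarrow> bool"
    (\<open>(_ \<approx>\<^bsub>_\<^esub> _)\<close> [51, 0, 51] 50)
  where "x \<approx>\<^bsub>R\<^esub> y \<longleftrightarrow> x - y \<in> rel_ideal R"

lemma rel_congI: "(l, r) \<in> R \<Longrightarrow> l \<approx>\<^bsub>R\<^esub> r"
  unfolding rel_cong_def by (rule rel_ideal_relation)

lemma rel_cong_refl: "x \<approx>\<^bsub>R\<^esub> x"
  by (simp add: rel_cong_def rel_ideal_zero)

lemma rel_cong_sym: "x \<approx>\<^bsub>R\<^esub> y \<Longrightarrow> y \<approx>\<^bsub>R\<^esub> x"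
  unfolding rel_cong_def using rel_ideal_uminus by fastforce

lemma rel_cong_trans [trans]: "x \<approx>\<^bsub>R\<^esub> y \<Longrightarrow> y \<approx>\<^bsub>R\<^esub> z \<Longrightarrow> x \<approx>\<^bsub>R\<^esub> z"
  unfolding rel_cong_def using rel_ideal_add by fastforce

lemma rel_cong_add: "x \<approx>\<^bsub>R\<^esub> x' \<Longrightarrow> y \<approx>\<^bsub>R\<^esub> y' \<Longrightarrow> x + y \<approx>\<^bsub>R\<^esub> x' + y'"
  unfolding rel_cong_def using rel_ideal_add by (metis add_diff_add)

lemma rel_cong_diff: "x \<approx>\<^bsub>R\<^esub> x' \<Longrightarrow> y \<approx>\<^bsub>R\<^esub> y' \<Longrightarrow> x - y \<approx>\<^bsub>R\<^esub> x' - y'"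
  unfolding rel_cong_def using rel_ideal_diff[of "x - x'" R "y - y'"] by (simp add: algebra_simps)

lemma rel_cong_mult:
  assumes "x \<approx>\<^bsub>R\<^esub> x'" and "y \<approx>\<^bsub>R\<^esub> y'"
  shows "x * y \<approx>\<^bsub>R\<^esub> x' * y'"
proof -
  have "x * y - x' * y' = (x - x') * y + x' * (y - y')"
    by (simp add: algebra_simps)
  then show ?thesis
    using assms unfolding rel_cong_def
    by (simp only: rel_ideal_add rel_ideal_mult_left rel_ideal_mult_right)
qed

lemma rel_cong_mult_left: "y \<approx>\<^bsub>R\<^esub> y' \<Longrightarrow> x * y \<approx>\<^bsub>R\<^esub> x * y'"
  by (rule rel_cong_mult[OF rel_cong_refl])

lemma rel_cong_mult_right: "x \<approx>\<^bsub>R\<^esub> x' \<Longrightarrow> x * y \<approx>\<^bsub>R\<^esub> x' * y"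
  by (rule rel_cong_mult[OF _ rel_cong_refl])

text \<open>The elements that a substitution sends into an ideal form an ideal, so it is enough to look at
  the generators of the ideal of relations. This is the universal property of a presentation.\<close>

lemma substitute_rel_cong:
  assumes rel: "\<And>l r. (l, r) \<in> R \<Longrightarrow> substitute \<phi> l \<approx>\<^bsub>S\<^esub> substitute \<phi> r"
    and "x \<approx>\<^bsub>R\<^esub> y"
  shows "substitute \<phi> x \<approx>\<^bsub>S\<^esub> substitute \<phi> y"
proof -
  interpret sub: ring_hom_ring free_ring free_ring "substitute \<phi>"
    by (rule ring_hom_ringI2[OF ring_free_ring ring_free_ring substitute_ring_hom])
  have "ideal {r \<in> carrier free_ring. substitute \<phi> r \<in> rel_ideal S} free_ring"
    by (rule sub.ideal_vimage[OF ideal_rel_ideal])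
  then have "rel_ideal R \<subseteq> {r. substitute \<phi> r \<in> rel_ideal S}"
    unfolding rel_ideal_def[of R]
    by (intro ring.genideal_minimal[OF ring_free_ring])
       (use rel in \<open>auto simp: rel_cong_def substitute_diff\<close>)
  then show ?thesis
    using assms(2) by (auto simp: rel_cong_def substitute_diff)
qed

text \<open>Both sides are algebra homomorphisms in \<open>x\<close>, and these are determined by their values on
  the generators.\<close>

lemma substitute_inverse:
  assumes gen: "\<And>g. substitute \<psi> (\<phi> g) \<approx>\<^bsub>R\<^esub> gen g"
  shows "substitute \<psi> (substitute \<phi> x) \<approx>\<^bsub>R\<^esub> x"
proof (induction x rule: poly_mapping_add_induct)
  case (single w v)
  have "substitute \<psi> (prod_list (map \<phi> gs)) \<approx>\<^bsub>R\<^esub> Poly_Mapping.single (Word gs) 1" for gs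
  proof (induction gs)
    case Nil
    show ?case by (simp add: substitute_one rel_cong_refl flip: zero_word_def)
  next
    case (Cons g gs)
    have "Poly_Mapping.single (Word (g # gs)) 1
        = (gen g * Poly_Mapping.single (Word gs) 1 :: ('a, 'b) free_alg)"
      by (simp add: gen_def mult_single plus_word_def)
    then show ?case
      by (simp add: substitute_mult rel_cong_mult[OF gen Cons.IH])
  qed
  from rel_cong_mult_left[OF this[of "letters w"], of "scal v"] show ?case
    by (simp add: substitute_single substitute_mult substitute_scal)
       (simp add: scal_def mult_single)
qed (simp_all add: substitute_simps rel_cong_refl rel_cong_add)


section \<open>Isomorphisms of presented algebras\<close>

lemma rel_ideal_coset_eq_iff:
  "rel_ideal R +>\<^bsub>free_ring\<^esub> x = rel_ideal R +>\<^bsub>free_ring\<^esub> y \<longleftrightarrow> x \<approx>\<^bsub>R\<^esub> y"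
proof -
  interpret ideal "rel_ideal R" free_ring by (rule ideal_rel_ideal)
  have "x \<ominus>\<^bsub>free_ring\<^esub> y = x - y"
    using minus_equality[of "- y" y] by (simp add: a_minus_def)
  then show ?thesis
    using quotient_eq_iff_same_a_r_cos[OF ideal_rel_ideal, of x y] by (simp add: rel_cong_def)
qed

lemma carrier_presented_ring:
  "carrier (presented_ring R) = range (\<lambda>x. rel_ideal R +>\<^bsub>free_ring\<^esub> x)"
  by (auto simp: presented_ring_def FactRing_def A_RCOSETS_def')

lemma coset_ring_hom: "(\<lambda>x. rel_ideal R +>\<^bsub>free_ring\<^esub> x) \<in> ring_hom free_ring (presented_ring R)"
  unfolding presented_ring_def by (rule ideal.rcos_ring_hom[OF ideal_rel_ideal])

lemma presented_algebra_simps: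
  "carrier (presented_algebra R) = carrier (presented_ring R)"
  "x \<otimes>\<^bsub>presented_algebra R\<^esub> y = x \<otimes>\<^bsub>presented_ring R\<^esub> y"
  "x \<oplus>\<^bsub>presented_algebra R\<^esub> y = x \<oplus>\<^bsub>presented_ring R\<^esub> y"
  "\<one>\<^bsub>presented_algebra R\<^esub> = \<one>\<^bsub>presented_ring R\<^esub>"
  "c \<odot>\<^bsub>presented_algebra R\<^esub> x = (rel_ideal R +>\<^bsub>free_ring\<^esub> scal c) \<otimes>\<^bsub>presented_ring R\<^esub> x"
  by (simp_all add: presented_algebra_def ring.defs module.defs)

text \<open>The map on cosets induced by \<open>\<phi>\<close> is well defined since \<open>\<phi>\<close> respects the relations \<open>R\<close>. It is
  injective because applying \<open>\<psi>\<close>, which respects \<open>S\<close>, recovers the argument, and surjective because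
  the coset of \<open>y\<close> comes from \<open>\<psi>\<close> applied to \<open>y\<close>. Scalar linearity is multiplicativity, as scalars
  act through the elements \<open>scal c\<close>, which substitutions fix.\<close>

lemma alg_iso_presented_algebra:
  assumes \<phi>: "\<And>l r. (l, r) \<in> R \<Longrightarrow> substitute \<phi> l \<approx>\<^bsub>S\<^esub> substitute \<phi> r"
    and \<psi>: "\<And>l r. (l, r) \<in> S \<Longrightarrow> substitute \<psi> l \<approx>\<^bsub>R\<^esub> substitute \<psi> r"
    and \<psi>\<phi>: "\<And>g. substitute \<psi> (\<phi> g) \<approx>\<^bsub>R\<^esub> gen g"
    and \<phi>\<psi>: "\<And>g. substitute \<phi> (\<psi> g) \<approx>\<^bsub>S\<^esub> gen g"
  shows "\<exists>h. h \<in> alg_iso (presented_algebra R) (presented_algebra S)"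
proof -
  let ?p = "\<lambda>x. rel_ideal R +>\<^bsub>free_ring\<^esub> x" and ?q = "\<lambda>x. rel_ideal S +>\<^bsub>free_ring\<^esub> x"
  define h where "h X = ?q (substitute \<phi> (SOME x. X = ?p x))" for X
  have h: "h (?p x) = ?q (substitute \<phi> x)" for x
  proof -
    have "?p x = ?p (SOME y. ?p x = ?p y)"
      by (rule someI) (rule refl)
    then have "x \<approx>\<^bsub>R\<^esub> (SOME y. ?p x = ?p y)"
      by (simp only: rel_ideal_coset_eq_iff)
    then show ?thesis
      unfolding h_def rel_ideal_coset_eq_iff
      by (intro rel_cong_sym[OF substitute_rel_cong[OF \<phi>]])
  qed
  note p = ring_hom_memE[OF coset_ring_hom[of R], simplified]
    and q = ring_hom_memE[OF coset_ring_hom[of S], simplified]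
  have "x \<approx>\<^bsub>R\<^esub> y" if "substitute \<phi> x \<approx>\<^bsub>S\<^esub> substitute \<phi> y" for x y
    using rel_cong_trans[OF rel_cong_trans[OF rel_cong_sym[OF substitute_inverse[OF \<psi>\<phi>]]
          substitute_rel_cong[OF \<psi> that]] substitute_inverse[OF \<psi>\<phi>]] .
  then have "inj_on h (range ?p)"
    by (auto simp: inj_on_def h rel_ideal_coset_eq_iff)
  moreover have "h (?p (substitute \<psi> y)) = ?q y" for y
    by (simp add: h rel_ideal_coset_eq_iff substitute_inverse[OF \<phi>\<psi>])
  then have "h ` range ?p = range ?q"
    by (auto simp: h image_iff) (metis)
  ultimately have "bij_betw h (range ?p) (range ?q)"
    by (simp add: bij_betw_def)
  then have "h \<in> alg_iso (presented_algebra R) (presented_algebra S)"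
    by (auto simp: alg_iso_def ring_iso_def ring_hom_def presented_algebra_simps
        carrier_presented_ring h substitute_simps simp flip: p q)
  then show ?thesis
    by blast
qed


section \<open>Commutation up to a scalar\<close>

text \<open>Commutation up to a scalar behaves like a bicharacter: the scalars multiply along products on
  either side and are inverted by exchanging the sides or inverting one of them. Where a lemma below
  changes the scalar, the new one is a variable tied by an equation (\<open>u = s * s'\<close> or \<open>s' * s = 1\<close>), so
  that the lemma applies to goals in which it is already simplified.\<close>

definition qcomm ::
    "(('g, 'k::comm_ring_1) free_alg \<times> ('g, 'k) free_alg) set
      \<Rightarrow> 'k \<Rightarrow> ('g, 'k) free_alg \<Rightarrow> ('g, 'k) free_alg \<Rightarrow> bool"
  where "qcomm R s x y \<longleftrightarrow> x * y \<approx>\<^bsub>R\<^esub> scal s * y * x"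

lemma scal_scal: "scal c * (scal d * x) = scal (c * d) * x"
  by (simp add: scal_mult mult.assoc)

lemma qcomm_one_iff: "qcomm R 1 x y \<longleftrightarrow> x * y \<approx>\<^bsub>R\<^esub> y * x"
  by (simp add: qcomm_def scal_one)

lemma qcomm_refl: "qcomm R 1 x x"
  by (simp add: qcomm_one_iff rel_cong_refl)

lemma qcomm_mult_left:
  assumes "qcomm R s x y" and "qcomm R s' x' y" and u: "u = s * s'"
  shows "qcomm R u (x * x') y"
proof -
  have "x * x' * y = x * (x' * y)"
    by (simp only: mult.assoc)
  also have "\<dots> \<approx>\<^bsub>R\<^esub> x * (scal s' * y * x')"
    using assms(2) unfolding qcomm_def by (rule rel_cong_mult_left)
  also have "x * (scal s' * y * x') = scal s' * (x * y * x')"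
    by (simp only: mult.assoc scal_left[of x])
  also have "\<dots> \<approx>\<^bsub>R\<^esub> scal s' * (scal s * y * x * x')"
    using assms(1) unfolding qcomm_def by (intro rel_cong_mult_left rel_cong_mult_right)
  also have "\<dots> = scal u * y * (x * x')"
    by (simp only: u mult.assoc scal_scal mult.commute[of s s'])
  finally show ?thesis
    by (simp only: qcomm_def)
qed

lemma qcomm_sym:
  assumes "qcomm R s x y" and "s' * s = 1"
  shows "qcomm R s' y x"
proof -
  have "y * x = scal s' * (scal s * y * x)"
    by (simp only: mult.assoc scal_scal assms(2)) (simp add: scal_one)
  also have "\<dots> \<approx>\<^bsub>R\<^esub> scal s' * (x * y)"
    using assms(1) unfolding qcomm_def by (rule rel_cong_mult_left[OF rel_cong_sym])
  finally show ?thesis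
    by (simp only: qcomm_def mult.assoc)
qed

lemma qcomm_one_sym: "qcomm R 1 x y \<Longrightarrow> qcomm R 1 y x"
  by (rule qcomm_sym) simp_all

lemma qcomm_mult_right:
  assumes "qcomm R s x y" and "qcomm R s' x y'" and u: "u = s * s'"
  shows "qcomm R u x (y * y')"
proof -
  have "x * (y * y') = x * y * y'"
    by (simp only: mult.assoc)
  also have "\<dots> \<approx>\<^bsub>R\<^esub> scal s * y * x * y'"
    using assms(1) unfolding qcomm_def by (rule rel_cong_mult_right)
  also have "\<dots> = scal s * y * (x * y')"
    by (simp only: mult.assoc)
  also have "\<dots> \<approx>\<^bsub>R\<^esub> scal s * y * (scal s' * y' * x)"
    using assms(2) unfolding qcomm_def by (rule rel_cong_mult_left)
  also have "\<dots> = scal u * (y * y') * x"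
    by (simp only: u mult.assoc scal_left[of y] scal_scal)
  finally show ?thesis
    by (simp only: qcomm_def)
qed

lemma qcomm_scal_left: "qcomm R s x y \<Longrightarrow> qcomm R s (scal c * x) y"
  by (rule qcomm_mult_left[of R 1])
     (simp_all add: qcomm_one_iff scal_commute[of y] rel_cong_refl)

lemma qcomm_scal_right: "qcomm R s x y \<Longrightarrow> qcomm R s x (scal c * y)"
  by (rule qcomm_mult_right[of R 1])
     (simp_all add: qcomm_one_iff scal_commute[of x] rel_cong_refl)

text \<open>Insert \<open>y' y\<close> on the left of \<open>x y'\<close> and move the new \<open>y\<close> past \<open>x\<close>, where it cancels.\<close>

lemma qcomm_inverse_right:
  assumes xy: "qcomm R s x y" and s: "s' * s = 1"
    and "y * y' \<approx>\<^bsub>R\<^esub> 1" and "y' * y \<approx>\<^bsub>R\<^esub> 1"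
  shows "qcomm R s' x y'"
proof -
  have "x * y' = 1 * (x * y')"
    by simp
  also have "\<dots> \<approx>\<^bsub>R\<^esub> y' * y * (x * y')"
    by (rule rel_cong_mult_right[OF rel_cong_sym[OF assms(4)]])
  also have "\<dots> = y' * (y * x) * y'"
    by (simp only: mult.assoc)
  also have "\<dots> \<approx>\<^bsub>R\<^esub> y' * (scal s' * x * y) * y'"
    using qcomm_sym[OF xy s] unfolding qcomm_def by (intro rel_cong_mult_left rel_cong_mult_right)
  also have "\<dots> = scal s' * y' * x * (y * y')"
    by (simp only: mult.assoc scal_left[of y'])
  also have "\<dots> \<approx>\<^bsub>R\<^esub> scal s' * y' * x * 1"
    by (rule rel_cong_mult_left[OF assms(3)])
  finally show ?thesis
    by (simp add: qcomm_def)
qed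

lemma qcomm_inverse_left:
  assumes "qcomm R s x y" and s: "s' * s = 1"
    and "x * x' \<approx>\<^bsub>R\<^esub> 1" and "x' * x \<approx>\<^bsub>R\<^esub> 1"
  shows "qcomm R s' x' y"
proof -
  have s': "s * s' = 1"
    using s by (simp only: mult.commute)
  show ?thesis
    by (rule qcomm_sym[OF qcomm_inverse_right[OF qcomm_sym[OF assms(1) s] s' assms(3,4)] s])
qed

lemma inverse_mult_cong:
  assumes "x * x' \<approx>\<^bsub>R\<^esub> 1" and "y * y' \<approx>\<^bsub>R\<^esub> 1"
  shows "x * y * (y' * x') \<approx>\<^bsub>R\<^esub> 1"
proof -
  have "x * y * (y' * x') = x * (y * y') * x'"
    by (simp only: mult.assoc)
  also have "\<dots> \<approx>\<^bsub>R\<^esub> x * 1 * x'"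
    by (intro rel_cong_mult_left rel_cong_mult_right assms(2))
  also have "\<dots> = x * x'"
    by simp
  also note assms(1)
  finally show ?thesis .
qed

lemma inverse_scal_cong:
  assumes "x * x' \<approx>\<^bsub>R\<^esub> 1" and "s * s' = 1"
  shows "(scal s * x) * (scal s' * x') \<approx>\<^bsub>R\<^esub> 1"
proof -
  have "(scal s * x) * (scal s' * x') = scal s * scal s' * (x * x')"
    by (simp only: mult.assoc scal_left[of x])
  also have "\<dots> = x * x'"
    by (simp add: assms(2) scal_one flip: scal_mult)
  finally show ?thesis
    using assms(1) by simp
qed

lemma conjugate_cong:
  assumes "qcomm R 1 x y" and "x * x' \<approx>\<^bsub>R\<^esub> 1"
  shows "x * y * x' \<approx>\<^bsub>R\<^esub> y"
proof -
  have "x * y * x' \<approx>\<^bsub>R\<^esub> y * x * x'"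
    using assms(1) unfolding qcomm_one_iff by (rule rel_cong_mult_right)
  also have "y * x * x' = y * (x * x')"
    by (simp only: mult.assoc)
  also have "\<dots> \<approx>\<^bsub>R\<^esub> y * 1"
    by (rule rel_cong_mult_left[OF assms(2)])
  finally show ?thesis
    by simp
qed


section \<open>The cell inside the localized oscillator algebra\<close>

text \<open>With this constant the two forms of the Casimir element become \<open>C = e f - \<kappa> t\<^sup>-\<^sup>1 k = f e - \<kappa> t k\<close>.\<close>

definition \<kappa> :: Ct
  where "\<kappa> = - inverse ((tt - inverse tt) ^ 2)"

lemma kappa_nonzero: "\<kappa> \<noteq> 0"
  using tt_diff_nonzero by (simp add: \<kappa>_def)

context
  fixes R :: "(('g, Ct) free_alg \<times> ('g, Ct) free_alg) set"
    and e f k k' h h' z z' :: "('g, Ct) free_alg"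
  assumes osc: "osc_relations e f k k' \<subseteq> R"
    and sqrt: "sqrt_relations e f k k' h h' \<subseteq> R"
    and z_def: "z = casimir e f k"
    and zz': "z * z' \<approx>\<^bsub>R\<^esub> 1" and z'z: "z' * z \<approx>\<^bsub>R\<^esub> 1"
begin

lemma osc_sqrt_relations:
  shows hh: "h * h \<approx>\<^bsub>R\<^esub> k" and h'h'_k': "h' * h' \<approx>\<^bsub>R\<^esub> k'"
    and hh': "h * h' \<approx>\<^bsub>R\<^esub> 1" and h'h: "h' * h \<approx>\<^bsub>R\<^esub> 1"
    and he: "qcomm R tt h e" and hf: "qcomm R (inverse tt) h f"
  unfolding qcomm_def by (rule rel_congI; rule subsetD[OF sqrt]; simp add: sqrt_relations_def)+

lemma casimir_qcomm:
  shows "qcomm R 1 z e" and "qcomm R 1 z f" and "qcomm R 1 z h"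
  unfolding qcomm_one_iff rel_cong_def z_def
  using casimir_commutes_e[OF osc] casimir_commutes_f[OF osc] casimir_commutes_sqrt(1)[OF osc sqrt]
  by simp_all

lemma casimir_inverse_qcomm: "qcomm R 1 z x \<Longrightarrow> qcomm R 1 z' x"
  by (rule qcomm_inverse_left[OF _ _ zz' z'z]) simp_all

lemmas z'_qcomm = casimir_qcomm[THEN casimir_inverse_qcomm]

text \<open>The next lemmas verify the relations of the cell for \<open>a = f\<close>, \<open>b = h\<close>, \<open>b\<^sup>-\<^sup>1 = h'\<close>, \<open>c = \<kappa> h z'\<close>,
  \<open>c\<^sup>-\<^sup>1 = \<kappa>\<^sup>-\<^sup>1 z h'\<close>, \<open>d = e z'\<close>. As \<open>z'\<close> is central, only \<open>h\<close> contributes a scalar.\<close>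

lemma cell_commutations:
  shows "qcomm R tt f h" and "qcomm R tt f (scal \<kappa> * (h * z'))"
    and "qcomm R tt h (e * z')" and "qcomm R tt (scal \<kappa> * (h * z')) (e * z')"
    and "qcomm R 1 h (scal \<kappa> * (h * z'))"
proof -
  show fh: "qcomm R tt f h"
    by (rule qcomm_sym[OF hf]) (simp add: tt_nonzero)
  have fz': "qcomm R 1 f z'" and hz': "qcomm R 1 h z'"
    by (rule z'_qcomm[THEN qcomm_one_sym])+
  show "qcomm R tt f (scal \<kappa> * (h * z'))"
    by (intro qcomm_scal_right qcomm_mult_right[OF fh fz']) simp
  show hd: "qcomm R tt h (e * z')"
    by (rule qcomm_mult_right[OF he hz']) simp
  have "qcomm R 1 z' (e * z')"
    by (rule qcomm_mult_right[OF z'_qcomm(1) qcomm_refl]) simp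
  then show "qcomm R tt (scal \<kappa> * (h * z')) (e * z')"
    by (intro qcomm_scal_left qcomm_mult_left[OF hd _ mult_1_right[symmetric]])
  show "qcomm R 1 h (scal \<kappa> * (h * z'))"
    by (intro qcomm_scal_right qcomm_mult_right[OF qcomm_refl hz']) simp
qed

lemma cell_inverses:
  shows "scal \<kappa> * (h * z') * (scal (inverse \<kappa>) * (z * h')) \<approx>\<^bsub>R\<^esub> 1"
    and "scal (inverse \<kappa>) * (z * h') * (scal \<kappa> * (h * z')) \<approx>\<^bsub>R\<^esub> 1"
  by (intro inverse_scal_cong inverse_mult_cong hh' h'h zz' z'z; simp add: kappa_nonzero)+

lemma cell_torus_part:
  "scal u * h * (scal \<kappa> * (h * z')) \<approx>\<^bsub>R\<^esub> scal (\<kappa> * u) * k * z'"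
proof -
  have "scal u * h * (scal \<kappa> * (h * z')) = scal (\<kappa> * u) * (h * h) * z'"
    by (simp only: mult.assoc scal_left[of h] scal_scal mult.commute[of u \<kappa>])
  also have "\<dots> \<approx>\<^bsub>R\<^esub> scal (\<kappa> * u) * k * z'"
    by (intro rel_cong_mult_left rel_cong_mult_right hh)
  finally show ?thesis .
qed

text \<open>This is \<open>C C\<^sup>-\<^sup>1 = 1\<close> with \<open>C\<close> written as \<open>f e - \<kappa> t k\<close>.\<close>

lemma cell_determinant_ad:
  "f * (e * z') - scal tt * h * (scal \<kappa> * (h * z')) \<approx>\<^bsub>R\<^esub> 1"
proof -
  have coeff: "scal (tt / (tt - inverse tt) ^ 2) = - scal (\<kappa> * tt)"
    by (simp add: \<kappa>_def field_simps flip: scal_uminus)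
  have "f * (e * z') - scal tt * h * (scal \<kappa> * (h * z'))
      \<approx>\<^bsub>R\<^esub> f * (e * z') - scal (\<kappa> * tt) * k * z'"
    by (intro rel_cong_diff rel_cong_refl cell_torus_part)
  also have "\<dots> = (f * e + scal (tt / (tt - inverse tt) ^ 2) * k) * z'"
    by (simp add: coeff algebra_simps)
  also have "\<dots> \<approx>\<^bsub>R\<^esub> z * z'"
    using casimir_alt[OF osc] unfolding z_def
    by (intro rel_cong_mult_right[OF rel_cong_sym]) (simp only: rel_cong_def)
  also note zz'
  finally show ?thesis .
qed

text \<open>This is \<open>C C\<^sup>-\<^sup>1 = 1\<close> with \<open>C\<close> written as \<open>e f - \<kappa> t\<^sup>-\<^sup>1 k\<close>.\<close>

lemma cell_determinant_da:
  "e * z' * f - scal (inverse tt) * h * (scal \<kappa> * (h * z')) \<approx>\<^bsub>R\<^esub> 1"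
proof -
  have coeff: "scal (inverse tt / (tt - inverse tt) ^ 2) = - scal (\<kappa> * inverse tt)"
    by (simp add: \<kappa>_def divide_inverse mult.commute flip: scal_uminus)
  have "e * z' * f = e * (z' * f)"
    by (simp only: mult.assoc)
  also have "\<dots> \<approx>\<^bsub>R\<^esub> e * (f * z')"
    using z'_qcomm(2) unfolding qcomm_one_iff by (rule rel_cong_mult_left)
  finally have "e * z' * f - scal (inverse tt) * h * (scal \<kappa> * (h * z'))
      \<approx>\<^bsub>R\<^esub> e * (f * z') - scal (\<kappa> * inverse tt) * k * z'"
    by (intro rel_cong_diff cell_torus_part)
  also have "\<dots> = z * z'"
    by (simp add: z_def casimir_def coeff algebra_simps)
  also note zz'
  finally show ?thesis .
qed

text \<open>Passing to the cell and back sends \<open>e\<close> and \<open>C\<^sup>-\<^sup>1\<close> to the left-hand sides below.\<close>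

lemma osc_round_trip:
  shows "e * z' * (scal \<kappa> * (h * (scal (inverse \<kappa>) * (z * h')))) \<approx>\<^bsub>R\<^esub> e"
    and "scal (inverse \<kappa>) * (scal \<kappa> * (h * z') * h') \<approx>\<^bsub>R\<^esub> z'"
proof -
  have 1: "scal \<kappa> * (h * (scal (inverse \<kappa>) * (z * h'))) = h * z * h'"
    by (simp only: mult.assoc scal_left[of h] scal_scal) (simp add: kappa_nonzero scal_one)
  have "e * z' * (h * z * h') \<approx>\<^bsub>R\<^esub> e * z' * z"
    by (rule rel_cong_mult_left[OF conjugate_cong[OF qcomm_one_sym[OF casimir_qcomm(3)] hh']])
  also have "\<dots> = e * (z' * z)"
    by (simp only: mult.assoc)
  also have "\<dots> \<approx>\<^bsub>R\<^esub> e * 1"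
    by (rule rel_cong_mult_left[OF z'z])
  finally show "e * z' * (scal \<kappa> * (h * (scal (inverse \<kappa>) * (z * h')))) \<approx>\<^bsub>R\<^esub> e"
    by (simp add: 1)
  have "scal (inverse \<kappa>) * (scal \<kappa> * (h * z') * h') = h * z' * h'"
    by (simp only: mult.assoc scal_scal) (simp add: kappa_nonzero scal_one)
  moreover have "h * z' * h' \<approx>\<^bsub>R\<^esub> z'"
    by (rule conjugate_cong[OF qcomm_one_sym[OF z'_qcomm(3)] hh'])
  ultimately show "scal (inverse \<kappa>) * (scal \<kappa> * (h * z') * h') \<approx>\<^bsub>R\<^esub> z'"
    by simp
qed

end


section \<open>The localized oscillator algebra inside the cell\<close>

context
  fixes R :: "(('g, Ct) free_alg \<times> ('g, Ct) free_alg) set"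
    and a b b' c c' d z z' :: "('g, Ct) free_alg"
  assumes ab: "qcomm R tt a b" and ac: "qcomm R tt a c"
    and bd: "qcomm R tt b d" and cd: "qcomm R tt c d" and bc: "qcomm R 1 b c"
    and bb': "b * b' \<approx>\<^bsub>R\<^esub> 1" and b'b: "b' * b \<approx>\<^bsub>R\<^esub> 1"
    and cc': "c * c' \<approx>\<^bsub>R\<^esub> 1" and c'c: "c' * c \<approx>\<^bsub>R\<^esub> 1"
    and ad: "a * d \<approx>\<^bsub>R\<^esub> 1 + scal tt * b * c"
    and da: "d * a \<approx>\<^bsub>R\<^esub> 1 + scal (inverse tt) * b * c"
    and z_def: "z = scal \<kappa> * (b * c')"
    and z'_def: "z' = scal (inverse \<kappa>) * (c * b')"
begin

lemma ba: "qcomm R (inverse tt) b a"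
  by (rule qcomm_sym[OF ab]) (simp add: tt_nonzero)

lemma bc': "qcomm R 1 b c'"
  by (rule qcomm_inverse_right[OF bc _ cc' c'c]) simp

text \<open>The element \<open>z\<close> plays the part of the Casimir element: the scalars of \<open>b\<close> and \<open>c\<close> against \<open>a\<close>, and
  likewise against \<open>d\<close>, agree and therefore cancel in \<open>b c'\<close>.\<close>

lemma z_qcomm: "qcomm R 1 z a" "qcomm R 1 z b" "qcomm R 1 z d"
proof -
  have "qcomm R (inverse tt) c a"
    by (rule qcomm_sym[OF ac]) (simp add: tt_nonzero)
  then have "qcomm R tt c' a"
    by (rule qcomm_inverse_left[OF _ _ cc' c'c]) (simp add: tt_nonzero)
  then show "qcomm R 1 z a"
    unfolding z_def by (intro qcomm_scal_left qcomm_mult_left[OF ba _ left_inverse[OF tt_nonzero, symmetric]])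
  have "qcomm R 1 c' b"
    by (rule qcomm_one_sym[OF bc'])
  then show "qcomm R 1 z b"
    unfolding z_def by (intro qcomm_scal_left qcomm_mult_left[OF qcomm_refl _ mult_1_right[symmetric]])
  have "qcomm R (inverse tt) c' d"
    by (rule qcomm_inverse_left[OF cd _ cc' c'c]) (simp add: tt_nonzero)
  then show "qcomm R 1 z d"
    unfolding z_def by (intro qcomm_scal_left qcomm_mult_left[OF bd _ right_inverse[OF tt_nonzero, symmetric]])
qed

lemma z_inverse: "z * z' \<approx>\<^bsub>R\<^esub> 1" "z' * z \<approx>\<^bsub>R\<^esub> 1"
  unfolding z_def z'_def
  by (intro inverse_scal_cong inverse_mult_cong bb' b'b cc' c'c; simp add: kappa_nonzero)+

lemma b_qcomm_dz: "qcomm R tt b (d * z)"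
  by (rule qcomm_mult_right[OF bd qcomm_one_sym[OF z_qcomm(2)]]) simp

lemma bb_qcomm: "qcomm R (tt ^ 2) (b * b) (d * z)" "qcomm R (inverse (tt ^ 2)) (b * b) a"
  by (rule qcomm_mult_left[OF b_qcomm_dz b_qcomm_dz] qcomm_mult_left[OF ba ba];
      simp add: power2_eq_square)+

text \<open>Multiplying by \<open>z = \<kappa> b c\<^sup>-\<^sup>1\<close> turns the off-diagonal term \<open>b c\<close> of the determinant relations into
  a multiple of \<open>b\<^sup>2 = k\<close>.\<close>

lemma bcz: "scal u * b * c * z \<approx>\<^bsub>R\<^esub> scal (\<kappa> * u) * (b * b)"
proof -
  have "scal u * b * c * z = scal (\<kappa> * u) * (b * (c * b) * c')"
    by (simp only: z_def mult.assoc scal_left[of c] scal_left[of b] scal_scal mult.commute[of u \<kappa>])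
  also have "\<dots> \<approx>\<^bsub>R\<^esub> scal (\<kappa> * u) * (b * (b * c) * c')"
    using bc unfolding qcomm_one_iff
    by (intro rel_cong_mult_left rel_cong_mult_right) (rule rel_cong_sym)
  also have "\<dots> = scal (\<kappa> * u) * (b * b * (c * c'))"
    by (simp only: mult.assoc)
  also have "\<dots> \<approx>\<^bsub>R\<^esub> scal (\<kappa> * u) * (b * b * 1)"
    by (intro rel_cong_mult_left cc')
  finally show ?thesis
    by simp
qed

lemma dza: "d * z * a \<approx>\<^bsub>R\<^esub> z + scal (\<kappa> * inverse tt) * (b * b)"
proof -
  have "d * z * a = d * (z * a)"
    by (simp only: mult.assoc)
  also have "\<dots> \<approx>\<^bsub>R\<^esub> d * (a * z)"
    using z_qcomm(1) unfolding qcomm_one_iff by (rule rel_cong_mult_left)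
  also have "\<dots> = d * a * z"
    by (simp only: mult.assoc)
  also have "\<dots> \<approx>\<^bsub>R\<^esub> (1 + scal (inverse tt) * b * c) * z"
    by (rule rel_cong_mult_right[OF da])
  also have "\<dots> = z + scal (inverse tt) * b * c * z"
    by (simp add: distrib_right)
  also have "\<dots> \<approx>\<^bsub>R\<^esub> z + scal (\<kappa> * inverse tt) * (b * b)"
    by (intro rel_cong_add rel_cong_refl bcz)
  finally show ?thesis .
qed

lemma adz: "a * (d * z) \<approx>\<^bsub>R\<^esub> z + scal (\<kappa> * tt) * (b * b)"
proof -
  have "a * (d * z) = a * d * z"
    by (simp only: mult.assoc)
  also have "\<dots> \<approx>\<^bsub>R\<^esub> (1 + scal tt * b * c) * z"
    by (rule rel_cong_mult_right[OF ad])
  also have "\<dots> = z + scal tt * b * c * z"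
    by (simp add: distrib_right)
  also have "\<dots> \<approx>\<^bsub>R\<^esub> z + scal (\<kappa> * tt) * (b * b)"
    by (intro rel_cong_add rel_cong_refl bcz)
  finally show ?thesis .
qed

text \<open>Subtracting the two determinant relations, multiplied by \<open>z\<close>, leaves a multiple of \<open>b\<^sup>2\<close> with
  coefficient \<open>\<kappa> (t\<^sup>-\<^sup>1 - t) = 1/(t - t\<^sup>-\<^sup>1)\<close>.\<close>

lemma commutator_in_cell:
  "d * z * a - a * (d * z) \<approx>\<^bsub>R\<^esub> scal (1 / (tt - inverse tt)) * (b * b)"
proof -
  define \<delta> where "\<delta> = tt - inverse tt"
  have \<delta>: "\<delta> \<noteq> 0"
    using tt_diff_nonzero by (simp add: \<delta>_def)
  have kappa: "\<kappa> = - inverse (\<delta> ^ 2)"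
    by (simp add: \<kappa>_def \<delta>_def)
  have "\<kappa> * inverse tt - \<kappa> * tt = - \<kappa> * \<delta>"
    by (simp add: \<delta>_def algebra_simps)
  also have "\<dots> = 1 / \<delta>"
    using \<delta> by (simp add: kappa power2_eq_square field_simps)
  finally have coeff: "scal (\<kappa> * inverse tt) - scal (\<kappa> * tt) = scal (1 / \<delta>)"
    by (metis scal_diff)
  have "d * z * a - a * (d * z)
      \<approx>\<^bsub>R\<^esub> (z + scal (\<kappa> * inverse tt) * (b * b)) - (z + scal (\<kappa> * tt) * (b * b))"
    by (rule rel_cong_diff[OF dza adz])
  also have "\<dots> = (scal (\<kappa> * inverse tt) - scal (\<kappa> * tt)) * (b * b)"
    by (simp add: left_diff_distrib)
  finally show ?thesis
    by (simp only: coeff \<delta>_def)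
qed

lemma casimir_in_cell: "casimir (d * z) a (b * b) \<approx>\<^bsub>R\<^esub> z"
proof -
  have coeff: "scal (inverse tt / (tt - inverse tt) ^ 2) = - scal (\<kappa> * inverse tt)"
    by (simp add: \<kappa>_def divide_inverse mult.commute flip: scal_uminus)
  have "casimir (d * z) a (b * b) = d * z * a - scal (\<kappa> * inverse tt) * (b * b)"
    by (simp add: casimir_def coeff)
  also have "\<dots> \<approx>\<^bsub>R\<^esub> (z + scal (\<kappa> * inverse tt) * (b * b)) - scal (\<kappa> * inverse tt) * (b * b)"
    by (rule rel_cong_diff[OF dza rel_cong_refl])
  finally show ?thesis
    by simp
qed

lemma casimir_inverse_in_cell:
  "casimir (d * z) a (b * b) * z' \<approx>\<^bsub>R\<^esub> 1" "z' * casimir (d * z) a (b * b) \<approx>\<^bsub>R\<^esub> 1"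
  using rel_cong_mult_right[OF casimir_in_cell] rel_cong_mult_left[OF casimir_in_cell]
    z_inverse rel_cong_trans by blast+

text \<open>Passing to the oscillator algebra and back sends \<open>c\<close>, \<open>c\<^sup>-\<^sup>1\<close> and \<open>d\<close> to the left-hand sides below.\<close>

lemma cell_round_trip:
  shows "scal \<kappa> * (b * z') \<approx>\<^bsub>R\<^esub> c"
    and "scal (inverse \<kappa>) * (casimir (d * z) a (b * b) * b') \<approx>\<^bsub>R\<^esub> c'"
    and "d * z * z' \<approx>\<^bsub>R\<^esub> d"
proof -
  have "scal \<kappa> * (b * z') = b * c * b'"
    by (simp only: z'_def mult.assoc scal_left[of b] scal_scal) (simp add: kappa_nonzero scal_one)
  then show "scal \<kappa> * (b * z') \<approx>\<^bsub>R\<^esub> c"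
    using conjugate_cong[OF bc bb'] by simp
  have "scal (inverse \<kappa>) * (casimir (d * z) a (b * b) * b')
      \<approx>\<^bsub>R\<^esub> scal (inverse \<kappa>) * (z * b')"
    by (intro rel_cong_mult_left rel_cong_mult_right casimir_in_cell)
  also have "\<dots> = b * c' * b'"
    by (simp only: z_def mult.assoc scal_scal) (simp add: kappa_nonzero scal_one)
  also have "\<dots> \<approx>\<^bsub>R\<^esub> c'"
    by (rule conjugate_cong[OF bc' bb'])
  finally show "scal (inverse \<kappa>) * (casimir (d * z) a (b * b) * b') \<approx>\<^bsub>R\<^esub> c'" .
  show "d * z * z' \<approx>\<^bsub>R\<^esub> d"
    using rel_cong_mult_left[OF z_inverse(1), of d] by (simp add: mult.assoc)
qed

end


section \<open>The isomorphism\<close>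

abbreviation casimir_gen :: "(osc_loc_gen, Ct) free_alg"
  where "casimir_gen \<equiv> casimir (gen (Osc E)) (gen (Osc F)) (gen (Osc K))"

fun cell_to_osc :: "cell_gen \<Rightarrow> (osc_loc_gen, Ct) free_alg"
  where
    "cell_to_osc Ga = gen (Osc F)"
  | "cell_to_osc Gb = gen Khalf"
  | "cell_to_osc Gbinv = gen Khalfinv"
  | "cell_to_osc Gc = scal \<kappa> * (gen Khalf * gen Cinv)"
  | "cell_to_osc Gcinv = scal (inverse \<kappa>) * (casimir_gen * gen Khalfinv)"
  | "cell_to_osc Gd = gen (Osc E) * gen Cinv"

fun osc_to_cell :: "osc_loc_gen \<Rightarrow> (cell_gen, Ct) free_alg"
  where
    "osc_to_cell (Osc E) = gen Gd * (scal \<kappa> * (gen Gb * gen Gcinv))"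
  | "osc_to_cell (Osc F) = gen Ga"
  | "osc_to_cell (Osc K) = gen Gb * gen Gb"
  | "osc_to_cell (Osc Kinv) = gen Gbinv * gen Gbinv"
  | "osc_to_cell Khalf = gen Gb"
  | "osc_to_cell Khalfinv = gen Gbinv"
  | "osc_to_cell Cinv = scal (inverse \<kappa>) * (gen Gc * gen Gbinv)"

lemma substitute_casimir:
  "substitute \<phi> (casimir e f k) = casimir (substitute \<phi> e) (substitute \<phi> f) (substitute \<phi> k)"
  by (simp add: casimir_def substitute_simps)

lemma cell_hypotheses:
  defines "a \<equiv> gen Ga" and "b \<equiv> gen Gb" and "b' \<equiv> gen Gbinv" and "c \<equiv> gen Gc"
    and "c' \<equiv> gen Gcinv" and "d \<equiv> gen Gd"
  shows "qcomm cell_relations tt a b" "qcomm cell_relations tt a c"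
    "qcomm cell_relations tt b d" "qcomm cell_relations tt c d" "qcomm cell_relations 1 b c"
    "b * b' \<approx>\<^bsub>cell_relations\<^esub> 1" "b' * b \<approx>\<^bsub>cell_relations\<^esub> 1"
    "c * c' \<approx>\<^bsub>cell_relations\<^esub> 1" "c' * c \<approx>\<^bsub>cell_relations\<^esub> 1"
    "a * d \<approx>\<^bsub>cell_relations\<^esub> 1 + scal tt * b * c"
    "d * a \<approx>\<^bsub>cell_relations\<^esub> 1 + scal (inverse tt) * b * c"
proof -
  have "a * d - scal tt * b * c \<approx>\<^bsub>cell_relations\<^esub> 1"
    "d * a - scal (inverse tt) * b * c \<approx>\<^bsub>cell_relations\<^esub> 1"
    by (rule rel_congI; simp add: cell_relations_def Let_def assms)+
  then show "a * d \<approx>\<^bsub>cell_relations\<^esub> 1 + scal tt * b * c"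
    "d * a \<approx>\<^bsub>cell_relations\<^esub> 1 + scal (inverse tt) * b * c"
    by (simp_all add: rel_cong_def algebra_simps)
qed (unfold qcomm_one_iff, unfold qcomm_def,
    (rule rel_congI; simp add: cell_relations_def Let_def assms)+)


lemma osc_loc_subsets:
  shows "osc_relations (gen (Osc E)) (gen (Osc F)) (gen (Osc K)) (gen (Osc Kinv))
      \<subseteq> osc_loc_relations"
    and "sqrt_relations (gen (Osc E)) (gen (Osc F)) (gen (Osc K)) (gen (Osc Kinv))
      (gen Khalf) (gen Khalfinv) \<subseteq> osc_loc_relations"
  by (auto simp: osc_loc_relations_def Let_def)

lemma casimir_gen_inverse:
  "casimir_gen * gen Cinv \<approx>\<^bsub>osc_loc_relations\<^esub> 1"
  "gen Cinv * casimir_gen \<approx>\<^bsub>osc_loc_relations\<^esub> 1"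
  by (rule rel_congI; simp add: osc_loc_relations_def Let_def)+

lemma cell_to_osc_relation:
  assumes "(l, r) \<in> cell_relations"
  shows "substitute cell_to_osc l \<approx>\<^bsub>osc_loc_relations\<^esub> substitute cell_to_osc r"
proof -
  note H = osc_loc_subsets refl casimir_gen_inverse
  show ?thesis
    using assms osc_sqrt_relations(3,4)[OF H] cell_commutations[OF H] cell_inverses[OF H]
      cell_determinant_ad[OF H] cell_determinant_da[OF H]
    unfolding cell_relations_def Let_def
    by (auto simp: substitute_simps qcomm_def scal_one)
qed

lemma osc_to_cell_relation:
  assumes "(l, r) \<in> osc_loc_relations"
  shows "substitute osc_to_cell l \<approx>\<^bsub>cell_relations\<^esub> substitute osc_to_cell r"
proof -
  note H = cell_hypotheses refl refl
  have "gen Gb * gen Gb * (gen Gbinv * gen Gbinv) \<approx>\<^bsub>cell_relations\<^esub> 1"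
    "gen Gbinv * gen Gbinv * (gen Gb * gen Gb) \<approx>\<^bsub>cell_relations\<^esub> 1"
    by (intro inverse_mult_cong cell_hypotheses(6,7))+
  then show ?thesis
    using assms cell_hypotheses(6,7) ba[OF H] b_qcomm_dz[OF H] bb_qcomm[OF H]
      commutator_in_cell[OF H] casimir_inverse_in_cell[OF H]
    unfolding osc_loc_relations_def osc_relations_def sqrt_relations_def Let_def
    by (auto simp: substitute_simps substitute_casimir qcomm_def rel_cong_refl)
qed

theorem corollary6p5:
  shows "\<exists>h. h \<in> alg_iso quantum_double_bruhat_cell_SL2 quantum_oscillator_loc"
  unfolding quantum_double_bruhat_cell_SL2_def quantum_oscillator_loc_def
proof (rule alg_iso_presented_algebra[OF cell_to_osc_relation osc_to_cell_relation])
  note H = cell_hypotheses refl refl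
  show "substitute osc_to_cell (cell_to_osc g) \<approx>\<^bsub>cell_relations\<^esub> gen g" for g
    using cell_round_trip[OF H]
    by (cases g) (simp_all add: substitute_simps substitute_casimir rel_cong_refl)
next
  note H = osc_loc_subsets refl casimir_gen_inverse
  show "substitute cell_to_osc (osc_to_cell g) \<approx>\<^bsub>osc_loc_relations\<^esub> gen g" for g
    using osc_round_trip[OF H] osc_sqrt_relations(1,2)[OF H]
    by (cases g rule: osc_to_cell.cases) (simp_all add: substitute_simps rel_cong_refl)
qed

end
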